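(* Let $R$ be a ring which is free as a $\mathbb{Z}$-module. Suppose that $W=\sum_i a_iU_i$ (a finite sum) with $a_i\in\mathbb{Z}$ and $U_i\in R$. Then, in $\mathcal{G}_\infty^{\mathbb{Q}}(R)[[t]]$, $$F_W(t)=\sum_i a_iF_{U_i}(t).$$
   Context: Rings are associative with unit. $\mathcal{G}_\infty^{\mathbb{Q}}(R)=\bigotimes_{i\ge 1}U(\mathbb{Q}\otimes_{\mathbb{Z}}R_i)$, where each $R_i$ is a copy of $R$, $\mathbb{Q}\otimes R$ is viewed as a Lie algebra via the commutator, $U(-)$ is the universal enveloping algebra, and the infinite tensor product is spanned by pure tensors with all but finitely many factors equal to $1$. For $r\in\mathbb{Q}\otimes R$, $T_i(r)$ is the image of $r$ under the canonical map $\mathbb{Q}\otimes R\to U(\mathbb{Q}\otimes R_i)\subset\mathcal{G}_\infty^{\mathbb{Q}}(R)$. For a formal power series $x$ with coefficients in $\mathbb{Q}\otimes R$ and constant term $1$, $\Theta_l(x)=\exp(T_l(\log x))$ ($T_l$ applied coefficientwise). For $U\in R$, $$E_U(t)=\sum_{r\ge 0}e_r(U)t^r=\prod_{l\ge 1}\Theta_l(1-(-t)^lU),\qquad F_U(t)=-\sum_{r\ge 1}\frac{\mu(r)}{r}\log\big(E_{U^r}(-t^r)\big),$$ where $\mu$ is the Möbius function. *)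

theory Defs
  imports
    "HOL-Computational_Algebra.Computational_Algebra"
    "HOL-Library.Poly_Mapping"
begin

section \<open>Rings, rational algebras, and free \<open>\<int>\<close>-modules\<close>

text \<open>
  A ring with unit is a type of sort \<open>{ring, monoid_mult}\<close>. Unlike \<^class>\<open>ring_1\<close> this admits the
  zero ring, which is needed because \<open>\<rat> \<otimes> R\<close> may vanish.
\<close>

definition zscale :: "int \<Rightarrow> 'a::ab_group_add \<Rightarrow> 'a"
  where "zscale k x = (\<Sum>i<nat k. x) - (\<Sum>i<nat (- k). x)"

lemma zscale_0 [simp]: "zscale 0 x = 0"
  by (simp add: zscale_def)

lemma zscale_plus1: "zscale (k + 1) x = zscale k x + x"
proof (cases "k \<ge> 0")
  case True
  then have "nat (k + 1) = Suc (nat k)" "nat (- k) = 0" "nat (- (k + 1)) = 0" by auto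
  then show ?thesis by (simp add: zscale_def add.commute)
next
  case False
  then have "nat (- k) = Suc (nat (- (k + 1)))" "nat k = 0" "nat (k + 1) = 0" by auto
  then show ?thesis by (simp add: zscale_def)
qed

lemma zscale_1 [simp]: "zscale 1 x = x"
  using zscale_plus1[of 0 x] by simp

lemma zscale_minus1: "zscale (k - 1) x = zscale k x - x"
  using zscale_plus1[of "k - 1" x] by (simp add: algebra_simps)

lemma zscale_add_right: "zscale k (x + y) = zscale k x + zscale k y"
  by (simp add: zscale_def sum.distrib algebra_simps)

lemma zscale_add_left: "zscale (k + l) x = zscale k x + zscale l x"
proof (induction l rule: int_induct[where k = 0])
  case base
  then show ?case by simp
next
  case (step1 i)
  then show ?case by (metis add.assoc zscale_plus1)
next
  case (step2 i)
  then show ?case by (metis add_diff_eq zscale_minus1)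
qed

lemma zscale_zscale: "zscale k (zscale l x) = zscale (k * l) x"
proof (induction k rule: int_induct[where k = 0])
  case base
  then show ?case by simp
next
  case (step1 i)
  then show ?case by (simp add: zscale_plus1 zscale_add_left distrib_right)
next
  case (step2 i)
  have "zscale (i * l - l) x = zscale (i * l) x - zscale l x"
    using zscale_add_left[of "i * l - l" l x] by simp
  with step2 show ?case by (simp add: zscale_minus1 left_diff_distrib)
qed

global_interpretation zmod: module "zscale :: int \<Rightarrow> 'a::ab_group_add \<Rightarrow> 'a"
  by standard (rule zscale_add_right zscale_add_left zscale_zscale zscale_1)+

definition free_Z_module :: "'a::ab_group_add itself \<Rightarrow> bool"
  where "free_Z_module _ \<longleftrightarrow> (\<exists>B :: 'a set. zmod.independent B \<and> zmod.span B = UNIV)"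

class scaleQ =
  fixes scaleQ :: "rat \<Rightarrow> 'a \<Rightarrow> 'a"  (infixr \<open>*\<^sub>Q\<close> 75)

class rat_algebra = scaleQ + ring + monoid_mult +
  assumes scaleQ_add_right: "a *\<^sub>Q (x + y) = a *\<^sub>Q x + a *\<^sub>Q y"
    and scaleQ_add_left: "(a + b) *\<^sub>Q x = a *\<^sub>Q x + b *\<^sub>Q x"
    and scaleQ_scaleQ: "a *\<^sub>Q (b *\<^sub>Q x) = (a * b) *\<^sub>Q x"
    and scaleQ_one: "1 *\<^sub>Q x = x"
    and mult_scaleQ_left: "(a *\<^sub>Q x) * y = a *\<^sub>Q (x * y)"
    and mult_scaleQ_right: "x * (a *\<^sub>Q y) = a *\<^sub>Q (x * y)"


section \<open>Quotients by two-sided ideals\<close>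

inductive_set ideal_hull :: "'b::ring_1 set \<Rightarrow> 'b set" for S where
  gen: "s \<in> S \<Longrightarrow> a * s * b \<in> ideal_hull S"
| zero: "0 \<in> ideal_hull S"
| add: "x \<in> ideal_hull S \<Longrightarrow> y \<in> ideal_hull S \<Longrightarrow> x + y \<in> ideal_hull S"

lemma ideal_hull_mult_left: "x \<in> ideal_hull S \<Longrightarrow> c * x \<in> ideal_hull S"
proof (induction rule: ideal_hull.induct)
  case (gen s a b)
  then show ?case using ideal_hull.gen[of s S "c * a" b] by (simp add: mult.assoc)
qed (simp_all add: ideal_hull.zero ideal_hull.add distrib_left)

lemma ideal_hull_mult_right: "x \<in> ideal_hull S \<Longrightarrow> x * c \<in> ideal_hull S"
proof (induction rule: ideal_hull.induct)
  case (gen s a b)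
  then show ?case using ideal_hull.gen[of s S a "b * c"] by (simp add: mult.assoc)
qed (simp_all add: ideal_hull.zero ideal_hull.add distrib_right)

lemma ideal_hull_uminus: "x \<in> ideal_hull S \<Longrightarrow> - x \<in> ideal_hull S"
  using ideal_hull_mult_left[of x S "- 1"] by simp

lemma ideal_hull_base: "s \<in> S \<Longrightarrow> s \<in> ideal_hull S"
  using ideal_hull.gen[of s S 1 1] by simp

definition ideal_cong :: "'b::ring_1 set \<Rightarrow> 'b \<Rightarrow> 'b \<Rightarrow> bool"
  where "ideal_cong S x y \<longleftrightarrow> x - y \<in> ideal_hull S"

lemma ideal_cong_refl: "ideal_cong S x x"
  by (simp add: ideal_cong_def ideal_hull.zero)

lemma ideal_cong_sym: "ideal_cong S x y \<Longrightarrow> ideal_cong S y x"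
  unfolding ideal_cong_def using ideal_hull_uminus[of "x - y" S] by simp

lemma ideal_cong_trans: "ideal_cong S x y \<Longrightarrow> ideal_cong S y z \<Longrightarrow> ideal_cong S x z"
  unfolding ideal_cong_def using ideal_hull.add[of "x - y" S "y - z"] by simp

lemma ideal_cong_add: "ideal_cong S x y \<Longrightarrow> ideal_cong S x' y' \<Longrightarrow> ideal_cong S (x + x') (y + y')"
  unfolding ideal_cong_def using ideal_hull.add[of "x - y" S "x' - y'"]
  by (simp add: algebra_simps)

lemma ideal_cong_uminus: "ideal_cong S x y \<Longrightarrow> ideal_cong S (- x) (- y)"
  unfolding ideal_cong_def using ideal_hull_uminus[of "x - y" S] by simp

lemma ideal_cong_diff: "ideal_cong S x y \<Longrightarrow> ideal_cong S x' y' \<Longrightarrow> ideal_cong S (x - x') (y - y')"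
  using ideal_cong_add[OF _ ideal_cong_uminus, of S x y x' y'] by simp

lemma ideal_cong_mult: "ideal_cong S x y \<Longrightarrow> ideal_cong S x' y' \<Longrightarrow> ideal_cong S (x * x') (y * y')"
  unfolding ideal_cong_def
  using ideal_hull.add[OF ideal_hull_mult_right[of "x - y" S x'] ideal_hull_mult_left[of "x' - y'" S y]]
  by (simp add: algebra_simps)

lemma equivp_ideal_cong: "equivp (ideal_cong S)"
  by (intro equivpI reflpI sympI transpI) (blast intro: ideal_cong_refl ideal_cong_sym ideal_cong_trans)+

lemma single_central:
  fixes p :: "'m::monoid_add \<Rightarrow>\<^sub>0 'k::semiring_0"
  assumes "\<And>k. m + k = k + m" and "\<And>d. c * d = d * c"
  shows "Poly_Mapping.single m c * p = p * Poly_Mapping.single m c"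
proof (induction p rule: update_induct)
  case const
  then show ?case by simp
next
  case (update f a b)
  have "Poly_Mapping.update a b f = f + Poly_Mapping.single a b"
    using update.hyps(1)
    by (intro poly_mapping_eqI) (auto simp: lookup_update lookup_add lookup_single in_keys_iff when_def)
  moreover have "Poly_Mapping.single m c * Poly_Mapping.single a b
      = Poly_Mapping.single a b * Poly_Mapping.single m c"
    using assms by (simp add: mult_single)
  ultimately show ?case using update.IH by (simp add: distrib_left distrib_right)
qed


section \<open>The ring \<open>\<rat> \<otimes> R\<close>\<close>

text \<open>
  \<open>\<rat> \<otimes> R\<close> is the free abelian group on the pairs \<open>(q, r)\<close> modulo the relations of biadditivity.
  The pairs form a monoid under componentwise multiplication, so the free abelian group is a monoid
  ring; as \<^typ>\<open>'a \<Rightarrow>\<^sub>0 'b\<close> takes its product from an additive monoid of keys, \<open>+\<close> below denotes the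
  multiplication of pairs. The product of a relation with a pair is again a relation, so the ideal
  generated by the relations is the subgroup generated by them.
\<close>

datatype 'a pure_tensor = Pure_Tensor rat 'a

instantiation pure_tensor :: (monoid_mult) monoid_add
begin

definition "0 = Pure_Tensor 1 (1::'a)"

fun plus_pure_tensor :: "'a pure_tensor \<Rightarrow> 'a pure_tensor \<Rightarrow> 'a pure_tensor"
  where "Pure_Tensor p r + Pure_Tensor q s = Pure_Tensor (p * q) (r * s)"

instance
proof
  fix x y z :: "'a pure_tensor"
  show "x + y + z = x + (y + z)" by (cases x; cases y; cases z) (simp add: mult.assoc)
  show "0 + x = x" by (cases x) (simp add: zero_pure_tensor_def)
  show "x + 0 = x" by (cases x) (simp add: zero_pure_tensor_def)
qed

end

definition ptens :: "rat \<Rightarrow> 'a \<Rightarrow> 'a pure_tensor \<Rightarrow>\<^sub>0 int"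
  where "ptens q r = Poly_Mapping.single (Pure_Tensor q r) 1"

definition biadditive_rels :: "('a::{ring, monoid_mult} pure_tensor \<Rightarrow>\<^sub>0 int) set"
  where "biadditive_rels =
    {ptens (p + q) r - ptens p r - ptens q r | p q r. True} \<union>
    {ptens q (r + s) - ptens q r - ptens q s | q r s. True}"

quotient_type (overloaded) 'a rat_tensor =
    "'a::{ring, monoid_mult} pure_tensor \<Rightarrow>\<^sub>0 int" / "ideal_cong biadditive_rels"
  by (rule equivp_ideal_cong)

lemma ptens_mult: "ptens p r * ptens q s = ptens (p * q) (r * (s::'a::monoid_mult))"
  by (simp add: ptens_def mult_single)

lemma ptens_one: "ptens 1 (1::'a::monoid_mult) = 1"
  by (simp add: ptens_def flip: zero_pure_tensor_def)

lemma ptens_central: "ptens q (1::'a::monoid_mult) * x = x * ptens q 1"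
proof -
  have "Pure_Tensor q 1 + k = k + Pure_Tensor q 1" for k :: "'a pure_tensor"
    by (cases k) (simp add: mult.commute)
  then show ?thesis by (simp add: ptens_def single_central)
qed

instantiation rat_tensor :: ("{ring, monoid_mult}") rat_algebra
begin

lift_definition zero_rat_tensor :: "'a rat_tensor" is 0 .
lift_definition one_rat_tensor :: "'a rat_tensor" is 1 .
lift_definition plus_rat_tensor :: "'a rat_tensor \<Rightarrow> 'a rat_tensor \<Rightarrow> 'a rat_tensor" is "(+)"
  by (rule ideal_cong_add)
lift_definition minus_rat_tensor :: "'a rat_tensor \<Rightarrow> 'a rat_tensor \<Rightarrow> 'a rat_tensor" is "(-)"
  by (rule ideal_cong_diff)
lift_definition uminus_rat_tensor :: "'a rat_tensor \<Rightarrow> 'a rat_tensor" is uminus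
  by (rule ideal_cong_uminus)
lift_definition times_rat_tensor :: "'a rat_tensor \<Rightarrow> 'a rat_tensor \<Rightarrow> 'a rat_tensor" is "(*)"
  by (rule ideal_cong_mult)
lift_definition scaleQ_rat_tensor :: "rat \<Rightarrow> 'a rat_tensor \<Rightarrow> 'a rat_tensor"
  is "\<lambda>q x. ptens q 1 * x"
  by (rule ideal_cong_mult[OF ideal_cong_refl])

instance
proof
  fix x y z :: "'a rat_tensor" and a b :: rat
  show "x + y + z = x + (y + z)" by transfer (simp add: add.assoc ideal_cong_refl)
  show "x + y = y + x" by transfer (simp add: add.commute ideal_cong_refl)
  show "0 + x = x" by transfer (simp add: ideal_cong_refl)
  show "- x + x = 0" by transfer (simp add: ideal_cong_refl)
  show "x - y = x + - y" by transfer (simp add: ideal_cong_refl)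
  show "x * y * z = x * (y * z)" by transfer (simp add: mult.assoc ideal_cong_refl)
  show "(x + y) * z = x * z + y * z" by transfer (simp add: distrib_right ideal_cong_refl)
  show "x * (y + z) = x * y + x * z" by transfer (simp add: distrib_left ideal_cong_refl)
  show "1 * x = x" by transfer (simp add: ideal_cong_refl)
  show "x * 1 = x" by transfer (simp add: ideal_cong_refl)
  show "a *\<^sub>Q (x + y) = a *\<^sub>Q x + a *\<^sub>Q y" by transfer (simp add: distrib_left ideal_cong_refl)
  show "(a + b) *\<^sub>Q x = a *\<^sub>Q x + b *\<^sub>Q x"
  proof transfer
    fix a b and x :: "'a pure_tensor \<Rightarrow>\<^sub>0 int"
    have "ptens (a + b) 1 - ptens a 1 - ptens b 1 \<in> (biadditive_rels :: ('a pure_tensor \<Rightarrow>\<^sub>0 int) set)"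
      by (auto simp: biadditive_rels_def)
    from ideal_hull_mult_right[OF ideal_hull_base[OF this], of x]
    show "ideal_cong biadditive_rels (ptens (a + b) 1 * x) (ptens a 1 * x + ptens b 1 * x)"
      by (simp add: ideal_cong_def algebra_simps)
  qed
  show "a *\<^sub>Q (b *\<^sub>Q x) = (a * b) *\<^sub>Q x"
    by transfer (simp add: ptens_mult ideal_cong_refl flip: mult.assoc)
  show "1 *\<^sub>Q x = x" by transfer (simp add: ptens_one ideal_cong_refl)
  show "(a *\<^sub>Q x) * y = a *\<^sub>Q (x * y)" by transfer (simp add: mult.assoc ideal_cong_refl)
  show "x * (a *\<^sub>Q y) = a *\<^sub>Q (x * y)"
    by transfer (simp add: ptens_central ideal_cong_refl mult.assoc)
qed

end

lift_definition rat_tensor_of :: "'a::{ring, monoid_mult} \<Rightarrow> 'a rat_tensor" is "ptens 1" .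


section \<open>The universal enveloping algebra\<close>

text \<open>
  For a rational algebra \<open>L\<close>, regarded as a Lie algebra with bracket \<open>[x, y] = x y - y x\<close>: the free
  associative \<open>\<rat>\<close>-algebra on the set \<open>L\<close>, modulo linearity of the inclusion of \<open>L\<close> (this yields the
  tensor algebra) and the relations \<open>x \<otimes> y - y \<otimes> x = [x, y]\<close>. The addition of words, which are the
  keys of the free algebra, is concatenation.
\<close>

datatype 'l free_word = Free_Word "'l list"

instantiation free_word :: (type) monoid_add
begin

definition "0 = Free_Word []"

fun plus_free_word :: "'a free_word \<Rightarrow> 'a free_word \<Rightarrow> 'a free_word"
  where "Free_Word v + Free_Word w = Free_Word (v @ w)"

instance
proof
  fix x y z :: "'a free_word"
  show "x + y + z = x + (y + z)" by (cases x; cases y; cases z) simp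
  show "0 + x = x" by (cases x) (simp add: zero_free_word_def)
  show "x + 0 = x" by (cases x) (simp add: zero_free_word_def)
qed

end

definition letter :: "'l \<Rightarrow> 'l free_word \<Rightarrow>\<^sub>0 rat"
  where "letter x = Poly_Mapping.single (Free_Word [x]) 1"

definition enveloping_rels :: "('l::rat_algebra free_word \<Rightarrow>\<^sub>0 rat) set"
  where "enveloping_rels =
    {letter (x + y) - letter x - letter y | x y. True} \<union>
    {letter (q *\<^sub>Q x) - Poly_Mapping.single 0 q * letter x | q x. True} \<union>
    {letter x * letter y - letter y * letter x - letter (x * y - y * x) | x y. True}"

quotient_type (overloaded) 'l enveloping =
    "'l::rat_algebra free_word \<Rightarrow>\<^sub>0 rat" / "ideal_cong enveloping_rels"
  by (rule equivp_ideal_cong)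

lemma single_zero_central:
  "Poly_Mapping.single 0 q * x = x * Poly_Mapping.single 0 (q::rat)" for x :: "'m::monoid_add \<Rightarrow>\<^sub>0 rat"
  by (simp add: single_central mult.commute)

instantiation enveloping :: (rat_algebra) rat_algebra
begin

lift_definition zero_enveloping :: "'a enveloping" is 0 .
lift_definition one_enveloping :: "'a enveloping" is 1 .
lift_definition plus_enveloping :: "'a enveloping \<Rightarrow> 'a enveloping \<Rightarrow> 'a enveloping" is "(+)"
  by (rule ideal_cong_add)
lift_definition minus_enveloping :: "'a enveloping \<Rightarrow> 'a enveloping \<Rightarrow> 'a enveloping" is "(-)"
  by (rule ideal_cong_diff)
lift_definition uminus_enveloping :: "'a enveloping \<Rightarrow> 'a enveloping" is uminus
  by (rule ideal_cong_uminus)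
lift_definition times_enveloping :: "'a enveloping \<Rightarrow> 'a enveloping \<Rightarrow> 'a enveloping" is "(*)"
  by (rule ideal_cong_mult)
lift_definition scaleQ_enveloping :: "rat \<Rightarrow> 'a enveloping \<Rightarrow> 'a enveloping"
  is "\<lambda>q x. Poly_Mapping.single 0 q * x"
  by (rule ideal_cong_mult[OF ideal_cong_refl])

instance
proof
  fix x y z :: "'a enveloping" and a b :: rat
  show "x + y + z = x + (y + z)" by transfer (simp add: add.assoc ideal_cong_refl)
  show "x + y = y + x" by transfer (simp add: add.commute ideal_cong_refl)
  show "0 + x = x" by transfer (simp add: ideal_cong_refl)
  show "- x + x = 0" by transfer (simp add: ideal_cong_refl)
  show "x - y = x + - y" by transfer (simp add: ideal_cong_refl)
  show "x * y * z = x * (y * z)" by transfer (simp add: mult.assoc ideal_cong_refl)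
  show "(x + y) * z = x * z + y * z" by transfer (simp add: distrib_right ideal_cong_refl)
  show "x * (y + z) = x * y + x * z" by transfer (simp add: distrib_left ideal_cong_refl)
  show "1 * x = x" by transfer (simp add: ideal_cong_refl)
  show "x * 1 = x" by transfer (simp add: ideal_cong_refl)
  show "a *\<^sub>Q (x + y) = a *\<^sub>Q x + a *\<^sub>Q y" by transfer (simp add: distrib_left ideal_cong_refl)
  show "(a + b) *\<^sub>Q x = a *\<^sub>Q x + b *\<^sub>Q x"
    by transfer (simp add: single_add distrib_right ideal_cong_refl)
  show "a *\<^sub>Q (b *\<^sub>Q x) = (a * b) *\<^sub>Q x"
    by transfer (simp add: mult_single ideal_cong_refl flip: mult.assoc)
  show "1 *\<^sub>Q x = x" by transfer (simp add: ideal_cong_refl)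
  show "(a *\<^sub>Q x) * y = a *\<^sub>Q (x * y)" by transfer (simp add: mult.assoc ideal_cong_refl)
  show "x * (a *\<^sub>Q y) = a *\<^sub>Q (x * y)"
    by transfer (simp add: single_zero_central ideal_cong_refl mult.assoc)
qed

end

lift_definition enveloping_of :: "'l::rat_algebra \<Rightarrow> 'l enveloping" is letter .


section \<open>The infinite tensor product\<close>

text \<open>
  The tensor product of copies \<open>A\<^sub>i\<close> (\<open>i \<ge> 1\<close>) of a rational algebra \<open>A\<close>: the \<open>\<rat>\<close>-vector space on
  the families \<open>(f i)\<close> with almost all \<open>f i = 1\<close>, modulo linearity in each component. Index \<open>0\<close> carries
  no information. Addition of families is componentwise multiplication. Again the product of
  a relation with a family is a relation, so the ideal generated by the relations is their linear
  span.
\<close>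

typedef (overloaded) 'u family = "{f :: nat \<Rightarrow> 'u::monoid_mult. f 0 = 1 \<and> finite {i. f i \<noteq> 1}}"
  morphisms component Family
  by (rule exI[of _ "\<lambda>_. 1"]) simp

setup_lifting type_definition_family

instantiation family :: (monoid_mult) monoid_add
begin

lift_definition zero_family :: "'a family" is "\<lambda>_. 1" by simp

lift_definition plus_family :: "'a family \<Rightarrow> 'a family \<Rightarrow> 'a family" is "\<lambda>f g i. f i * g i"
proof -
  fix f g :: "nat \<Rightarrow> 'a"
  assume *: "f 0 = 1 \<and> finite {i. f i \<noteq> 1}" "g 0 = 1 \<and> finite {i. g i \<noteq> 1}"
  have "{i. f i * g i \<noteq> 1} \<subseteq> {i. f i \<noteq> 1} \<union> {i. g i \<noteq> 1}" by auto
  with * show "f 0 * g 0 = 1 \<and> finite {i. f i * g i \<noteq> 1}"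
    by (auto intro: finite_subset)
qed

instance
proof
  fix f g h :: "'a family"
  show "f + g + h = f + (g + h)"
    by (simp add: component_inject[symmetric] plus_family.rep_eq mult.assoc)
  show "0 + f = f"
    by (simp add: component_inject[symmetric] plus_family.rep_eq zero_family.rep_eq)
  show "f + 0 = f"
    by (simp add: component_inject[symmetric] plus_family.rep_eq zero_family.rep_eq)
qed

end

lift_definition family_upd :: "'u::monoid_mult family \<Rightarrow> nat \<Rightarrow> 'u \<Rightarrow> 'u family"
  is "\<lambda>f i x. if i = 0 then f else f(i := x)"
proof -
  fix f :: "nat \<Rightarrow> 'u" and i :: nat and x :: 'u
  assume *: "f 0 = 1 \<and> finite {i. f i \<noteq> 1}"
  have "{j. (if i = 0 then f else f(i := x)) j \<noteq> 1} \<subseteq> insert i {i. f i \<noteq> 1}"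
    by (auto split: if_splits)
  moreover have "finite (insert i {i. f i \<noteq> 1})"
    using * by simp
  ultimately have "finite {j. (if i = 0 then f else f(i := x)) j \<noteq> 1}"
    by (rule finite_subset)
  with * show "(if i = 0 then f else f(i := x)) 0 = 1 \<and>
      finite {j. (if i = 0 then f else f(i := x)) j \<noteq> 1}"
    by simp
qed

definition pfam :: "'u::monoid_mult family \<Rightarrow> 'u family \<Rightarrow>\<^sub>0 rat"
  where "pfam f = Poly_Mapping.single f 1"

definition multilinear_rels :: "('u::rat_algebra family \<Rightarrow>\<^sub>0 rat) set"
  where "multilinear_rels =
    {pfam (family_upd f i (x + y)) - pfam (family_upd f i x) - pfam (family_upd f i y)
      | f i x y. i \<ge> 1} \<union>
    {pfam (family_upd f i (q *\<^sub>Q x)) - Poly_Mapping.single 0 q * pfam (family_upd f i x)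
      | f i q x. i \<ge> 1}"

quotient_type (overloaded) 'u inf_tensor =
    "'u::rat_algebra family \<Rightarrow>\<^sub>0 rat" / "ideal_cong multilinear_rels"
  by (rule equivp_ideal_cong)

instantiation inf_tensor :: (rat_algebra) rat_algebra
begin

lift_definition zero_inf_tensor :: "'a inf_tensor" is 0 .
lift_definition one_inf_tensor :: "'a inf_tensor" is 1 .
lift_definition plus_inf_tensor :: "'a inf_tensor \<Rightarrow> 'a inf_tensor \<Rightarrow> 'a inf_tensor" is "(+)"
  by (rule ideal_cong_add)
lift_definition minus_inf_tensor :: "'a inf_tensor \<Rightarrow> 'a inf_tensor \<Rightarrow> 'a inf_tensor" is "(-)"
  by (rule ideal_cong_diff)
lift_definition uminus_inf_tensor :: "'a inf_tensor \<Rightarrow> 'a inf_tensor" is uminus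
  by (rule ideal_cong_uminus)
lift_definition times_inf_tensor :: "'a inf_tensor \<Rightarrow> 'a inf_tensor \<Rightarrow> 'a inf_tensor" is "(*)"
  by (rule ideal_cong_mult)
lift_definition scaleQ_inf_tensor :: "rat \<Rightarrow> 'a inf_tensor \<Rightarrow> 'a inf_tensor"
  is "\<lambda>q x. Poly_Mapping.single 0 q * x"
  by (rule ideal_cong_mult[OF ideal_cong_refl])

instance
proof
  fix x y z :: "'a inf_tensor" and a b :: rat
  show "x + y + z = x + (y + z)" by transfer (simp add: add.assoc ideal_cong_refl)
  show "x + y = y + x" by transfer (simp add: add.commute ideal_cong_refl)
  show "0 + x = x" by transfer (simp add: ideal_cong_refl)
  show "- x + x = 0" by transfer (simp add: ideal_cong_refl)
  show "x - y = x + - y" by transfer (simp add: ideal_cong_refl)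
  show "x * y * z = x * (y * z)" by transfer (simp add: mult.assoc ideal_cong_refl)
  show "(x + y) * z = x * z + y * z" by transfer (simp add: distrib_right ideal_cong_refl)
  show "x * (y + z) = x * y + x * z" by transfer (simp add: distrib_left ideal_cong_refl)
  show "1 * x = x" by transfer (simp add: ideal_cong_refl)
  show "x * 1 = x" by transfer (simp add: ideal_cong_refl)
  show "a *\<^sub>Q (x + y) = a *\<^sub>Q x + a *\<^sub>Q y" by transfer (simp add: distrib_left ideal_cong_refl)
  show "(a + b) *\<^sub>Q x = a *\<^sub>Q x + b *\<^sub>Q x"
    by transfer (simp add: single_add distrib_right ideal_cong_refl)
  show "a *\<^sub>Q (b *\<^sub>Q x) = (a * b) *\<^sub>Q x"
    by transfer (simp add: mult_single ideal_cong_refl flip: mult.assoc)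
  show "1 *\<^sub>Q x = x" by transfer (simp add: ideal_cong_refl)
  show "(a *\<^sub>Q x) * y = a *\<^sub>Q (x * y)" by transfer (simp add: mult.assoc ideal_cong_refl)
  show "x * (a *\<^sub>Q y) = a *\<^sub>Q (x * y)"
    by transfer (simp add: single_zero_central ideal_cong_refl mult.assoc)
qed

end

text \<open>
  The canonical map of \<open>A\<^sub>i\<close> into the tensor product for \<open>i \<ge> 1\<close>; at \<open>i = 0\<close> it is the junk value \<open>1\<close>.
\<close>

lift_definition inf_tensor_of :: "nat \<Rightarrow> 'u::rat_algebra \<Rightarrow> 'u inf_tensor"
  is "\<lambda>i x. pfam (family_upd 0 i x)" .

type_synonym 'a G_inf = "'a rat_tensor enveloping inf_tensor"

definition T_map :: "nat \<Rightarrow> 'a::{ring, monoid_mult} rat_tensor \<Rightarrow> 'a G_inf"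
  where "T_map i r = inf_tensor_of i (enveloping_of r)"


section \<open>Power series\<close>

text \<open>
  The library has powers of series only over \<^class>\<open>semiring_1\<close>, which excludes the zero ring.
\<close>

instance fps :: ("{semiring_0, monoid_mult}") monoid_mult
proof
  fix a :: "'a fps"
  show "1 * a = a"
    by (simp add: fps_ext fps_mult_nth if_distrib if_distribR cong: if_cong)
  show "a * 1 = a"
    by (simp add: fps_ext fps_mult_nth if_distrib if_distribR cong: if_cong)
qed

instantiation fps :: (rat_algebra) rat_algebra
begin

definition "a *\<^sub>Q (x :: 'a fps) = Abs_fps (\<lambda>n. a *\<^sub>Q (x $ n))"

instance
proof
  fix x y z :: "'a fps" and a b :: rat
  have zero: "a *\<^sub>Q (0::'a) = 0" for a
    using scaleQ_add_right[of a "0::'a" 0] by simp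
  have sum: "a *\<^sub>Q (\<Sum>i\<in>I. f i) = (\<Sum>i\<in>I. a *\<^sub>Q (f i :: 'a))" for a f and I :: "nat set"
    by (induction I rule: infinite_finite_induct) (simp_all add: zero scaleQ_add_right)
  show "a *\<^sub>Q (x + y) = a *\<^sub>Q x + a *\<^sub>Q y"
    by (simp add: scaleQ_fps_def fps_eq_iff scaleQ_add_right)
  show "(a + b) *\<^sub>Q x = a *\<^sub>Q x + b *\<^sub>Q x"
    by (simp add: scaleQ_fps_def fps_eq_iff scaleQ_add_left)
  show "a *\<^sub>Q (b *\<^sub>Q x) = (a * b) *\<^sub>Q x"
    by (simp add: scaleQ_fps_def fps_eq_iff scaleQ_scaleQ)
  show "1 *\<^sub>Q x = x"
    by (simp add: scaleQ_fps_def fps_eq_iff scaleQ_one)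
  show "(a *\<^sub>Q x) * y = a *\<^sub>Q (x * y)"
    by (simp add: scaleQ_fps_def fps_eq_iff fps_mult_nth sum mult_scaleQ_left)
  show "x * (a *\<^sub>Q y) = a *\<^sub>Q (x * y)"
    by (simp add: scaleQ_fps_def fps_eq_iff fps_mult_nth sum mult_scaleQ_right)
qed

end

text \<open>
  Infinite sums and limits of series are taken in the library's metric on \<^typ>\<open>'a fps\<close>, the formal
  (\<open>t\<close>-adic) one. The series below converge when \<open>x\<close> has constant term \<open>1\<close> in \<open>fps_Log x\<close>, and \<open>y\<close>
  has constant term \<open>0\<close> in \<open>fps_Exp y\<close> and \<open>fps_subst f y\<close>.
\<close>

definition fps_Log :: "'a::rat_algebra fps \<Rightarrow> 'a fps"
  where "fps_Log x = suminf (\<lambda>n. ((-1) ^ n / of_nat (Suc n)) *\<^sub>Q (x - 1) ^ Suc n)"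

definition fps_Exp :: "'a::rat_algebra fps \<Rightarrow> 'a fps"
  where "fps_Exp y = suminf (\<lambda>n. (1 / fact n) *\<^sub>Q y ^ n)"

definition fps_subst :: "'a::{ring, monoid_mult} fps \<Rightarrow> 'a fps \<Rightarrow> 'a fps"
  where "fps_subst f y = suminf (\<lambda>k. fps_const (f $ k) * y ^ k)"

definition fps_map :: "('a \<Rightarrow> 'b) \<Rightarrow> 'a fps \<Rightarrow> 'b fps"
  where "fps_map h x = Abs_fps (\<lambda>n. h (x $ n))"

definition Theta :: "nat \<Rightarrow> 'a::{ring, monoid_mult} rat_tensor fps \<Rightarrow> 'a G_inf fps"
  where "Theta l x = fps_Exp (fps_map (T_map l) (fps_Log x))"

text \<open>
  The \<open>l\<close>-th factor is congruent to \<open>1\<close> modulo \<open>t ^ l\<close>, so the partial products converge. The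
  factors commute with each other, but their ring is not commutative, hence \<^const>\<open>prod_list\<close>.
\<close>

definition E_series :: "'a::{ring, monoid_mult} \<Rightarrow> 'a G_inf fps"
  where "E_series U = lim (\<lambda>N. prod_list
    (map (\<lambda>l. Theta l (1 - (- fps_X) ^ l * fps_const (rat_tensor_of U))) [1..<Suc N]))"

definition moebius_mu :: "nat \<Rightarrow> rat"
  where "moebius_mu n = (if squarefree n then (-1) ^ card (prime_factors n) else 0)"

definition F_series :: "'a::{ring, monoid_mult} \<Rightarrow> 'a G_inf fps"
  where "F_series U = - suminf (\<lambda>n. let r = Suc n in
    (moebius_mu r / of_nat r) *\<^sub>Q fps_Log (fps_subst (E_series (U ^ r)) (- (fps_X ^ r))))"

end

theory Submission
  imports Defs
begin

text \<open>
  The factors of \<open>E\<^sub>U\<close> commute, so \<open>log E\<^sub>U(t) = - \<Sum>\<^sub>l \<Sum>\<^sub>k (-t)\<^bsup>lk\<^esup> T\<^sub>l(U\<^bsup>k\<^esup>) / k\<close> over \<open>l, k \<ge> 1\<close>. Hence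
  \<open>F\<^sub>U(t) = \<Sum>\<^sub>l \<Sum>\<^sub>r \<Sum>\<^sub>k \<mu>(r) t\<^bsup>rlk\<^esup> T\<^sub>l(U\<^bsup>rk\<^esup>) / (rk)\<close>, and collecting the terms with fixed \<open>rk\<close> leaves
  \<open>F\<^sub>U(t) = \<Sum>\<^sub>l T\<^sub>l(U) t\<^bsup>l\<^esup>\<close>, because the sum of \<open>\<mu>\<close> over the divisors of \<open>n > 1\<close> vanishes. This is
  additive in \<open>U\<close>.
\<close>

section \<open>Rational scalars acting on algebras and on series\<close>

interpretation ratmod: module "scaleQ :: rat \<Rightarrow> 'a::rat_algebra \<Rightarrow> 'a"
  by standard (rule scaleQ_add_right scaleQ_add_left scaleQ_scaleQ scaleQ_one)+

lemma scaleQ_power: "(q *\<^sub>Q x) ^ n = q ^ n *\<^sub>Q (x :: 'a::rat_algebra) ^ n"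
  by (induction n) (simp_all add: mult_scaleQ_left mult_scaleQ_right mult.commute)

lemma fps_scaleQ_nth [simp]: "(q *\<^sub>Q f) $ n = q *\<^sub>Q (f $ n)"
  by (simp add: scaleQ_fps_def)

section \<open>Sums of the Moebius function\<close>

text \<open>Only squarefree divisors contribute, and taking prime factors matches them with the
  subsets of the set of primes dividing \<open>n\<close>. The alternating sum over the subsets of a
  nonempty finite set is 0; the set of primes is empty exactly for \<open>n = 1\<close>.\<close>

lemma moebius_sum_divisors:
  assumes "n > 0"
  shows "(\<Sum>d | d dvd n. moebius_mu d) = (if n = 1 then 1 else 0)"
proof -
  let ?P = "prime_factors n"
  have fin: "finite X" and primes: "p \<in> X \<Longrightarrow> prime p" if "X \<subseteq> ?P" for X p
    using that finite_subset[OF that] by auto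
  have pf: "prime_factors (\<Prod>X) = X" if "X \<subseteq> ?P" for X
  proof -
    have "0 \<notin> (\<lambda>p. p) ` X" using primes[OF that] by (auto dest: prime_gt_0_nat)
    then have "prime_factors (\<Prod>X) = (\<Union>p\<in>X. prime_factors p)"
      using prime_factors_prod[OF fin[OF that], of "\<lambda>p. p"] by simp
    also have "\<dots> = X" using primes[OF that] by (auto simp: prime_prime_factors)
    finally show ?thesis .
  qed
  have sqf: "squarefree (\<Prod>X)" if "X \<subseteq> ?P" for X
    using primes[OF that] by (intro squarefree_prod_coprime) (auto simp: primes_coprime squarefree_prime)
  have dvd: "\<Prod>X dvd n" if "X \<subseteq> ?P" for X
  proof -
    have "\<Prod>X dvd \<Prod>?P" by (rule prod_dvd_prod_subset) (use that in auto)
    also have "\<dots> dvd (\<Prod>p\<in>?P. p ^ multiplicity p n)"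
      by (intro prod_dvd_prod) (auto simp: prime_factors_multiplicity)
    also have "\<dots> = n" using assms by (simp add: prod_prime_factors)
    finally show ?thesis .
  qed
  have prod: "\<Prod>(prime_factors d) = d" if "squarefree d" for d :: nat
  proof -
    have "d \<noteq> 0" using that by (intro notI) simp
    then have "(\<Prod>p\<in>prime_factors d. p ^ multiplicity p d) = d" by (simp add: prod_prime_factors)
    moreover have "\<forall>p\<in>prime_factors d. multiplicity p d = 1"
      using that \<open>d \<noteq> 0\<close> squarefree_factorial_semiring' by blast
    ultimately show ?thesis by simp
  qed
  have "(\<Sum>d | d dvd n. moebius_mu d) = (\<Sum>d | d dvd n \<and> squarefree d. (-1) ^ card (prime_factors d))"
    using assms by (intro sum.mono_neutral_cong_right) (auto simp: moebius_mu_def)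
  also have "\<dots> = (\<Sum>X\<in>Pow ?P. (-1) ^ card X)"
    by (rule sum.reindex_bij_witness[where i = "\<lambda>X. \<Prod>X" and j = prime_factors])
      (use assms in \<open>auto simp: pf sqf dvd prod dest: dvd_prime_factors[rotated]\<close>)
  \<comment> \<open>Expanding the product by \<open>prod_add\<close> chooses the summand -1 at the
    primes of \<open>X\<close> and 1 at the others.\<close>
  also have "\<dots> = (\<Prod>p\<in>?P. (-1) + 1)"
    by (subst prod_add) simp_all
  also have "\<dots> = (if n = 1 then 1 else 0)"
    using assms by (auto simp: prime_factorization_empty_iff power_0_left)
  finally show ?thesis .
qed

section \<open>Exponential and logarithm with noncommuting coefficients\<close>

text \<open>The \<open>i\<close>-th term starts in degree \<open>i\<close> or later, so the
  coefficient at \<open>n\<close> of the partial sums is constant once \<open>N > n\<close>. This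
  yields convergence and reduces the infinite sums below to finite ones.\<close>

lemma fps_suminf_nth:
  fixes f :: "nat \<Rightarrow> 'a::ab_group_add fps"
  assumes "\<And>i j. j < i \<Longrightarrow> f i $ j = 0"
  shows "suminf f $ m = (\<Sum>i\<le>m. f i $ m)"
proof -
  have "f sums Abs_fps (\<lambda>m. \<Sum>i\<le>m. f i $ m)"
    unfolding sums_def
  proof (rule tendsto_fpsI)
    fix n
    show "\<forall>\<^sub>F N in sequentially. (\<Sum>i<N. f i) $ n = Abs_fps (\<lambda>m. \<Sum>i\<le>m. f i $ m) $ n"
      using eventually_gt_at_top[of n]
    proof eventually_elim
      case (elim N)
      have "(\<Sum>i<N. f i $ n) = (\<Sum>i\<le>n. f i $ n)"
        using elim assms by (intro sum.mono_neutral_right) auto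
      then show ?case by (simp add: fps_sum_nth)
    qed
  qed
  then show ?thesis by (simp add: sums_unique[symmetric])
qed

lemma fps_power_nth_eq_0:
  fixes y :: "'a::{ring, monoid_mult} fps"
  assumes "y $ 0 = 0" "m < k"
  shows "(y ^ k) $ m = 0"
  using assms(2)
proof (induction k arbitrary: m)
  case (Suc k)
  have "y $ i * (y ^ k) $ (m - i) = 0" if "i \<le> m" for i
    using that Suc.prems assms(1) by (cases "i = 0") (simp_all add: Suc.IH)
  then show ?case by (simp add: fps_mult_nth)
qed simp

lemma fps_mult_nth_eq_0:
  fixes f g :: "'a::ring fps"
  assumes "\<And>j. j < i \<Longrightarrow> f $ j = 0" "\<And>j. j < k \<Longrightarrow> g $ j = 0" "m < i + k"
  shows "(f * g) $ m = 0"
proof -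
  have "f $ j * g $ (m - j) = 0" if "j \<le> m" for j
    using assms that by (cases "j < i") auto
  then show ?thesis by (simp add: fps_mult_nth)
qed

text \<open>This is the Cauchy product; in every fixed degree only finite sums have to be
  rearranged.\<close>

lemma fps_suminf_mult:
  fixes A B :: "nat \<Rightarrow> 'a::ring fps"
  assumes A: "\<And>i j. j < i \<Longrightarrow> A i $ j = 0" and B: "\<And>i j. j < i \<Longrightarrow> B i $ j = 0"
  shows "suminf A * suminf B = suminf (\<lambda>n. \<Sum>i\<le>n. A i * B (n - i))"
proof (rule fps_ext)
  fix m
  have AB: "(A i * B k) $ j = 0" if "j < i + k" for i j k
    using A B that by (rule fps_mult_nth_eq_0)
  have "(suminf A * suminf B) $ m =
      (\<Sum>j=0..m. (\<Sum>i\<le>m. A i $ j) * (\<Sum>k\<le>m. B k $ (m - j)))"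
  proof -
    \<comment> \<open>The bounds are raised to \<open>m\<close>, so that they no longer depend on
      \<open>j\<close> and the sums can be interchanged.\<close>
    have "(\<Sum>i\<le>j. A i $ j) = (\<Sum>i\<le>m. A i $ j)" "(\<Sum>i\<le>j. B i $ j) = (\<Sum>i\<le>m. B i $ j)" if "j \<le> m" for j
      using that A B by (intro sum.mono_neutral_left; auto)+
    then show ?thesis
      by (simp add: fps_mult_nth fps_suminf_nth[of A, OF A] fps_suminf_nth[of B, OF B])
  qed
  also have "\<dots> = (\<Sum>j=0..m. \<Sum>i\<le>m. \<Sum>k\<le>m. A i $ j * B k $ (m - j))"
    by (simp add: sum_product)
  also have "\<dots> = (\<Sum>i\<le>m. \<Sum>k\<le>m. \<Sum>j=0..m. A i $ j * B k $ (m - j))"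
    by (subst sum.swap, rule sum.cong[OF refl], rule sum.swap)
  also have "\<dots> = (\<Sum>(i, k)\<in>{..m} \<times> {..m}. (A i * B k) $ m)"
    by (simp only: fps_mult_nth sum.cartesian_product[symmetric])
  \<comment> \<open>The product \<open>A i * B k\<close> starts in degree \<open>i + k\<close>,
    which cuts the square down to a triangle; the triangle is then summed along its
    diagonals.\<close>
  also have "\<dots> = (\<Sum>(i, k)\<in>{(i, k). i + k \<le> m}. (A i * B k) $ m)"
    by (intro sum.mono_neutral_right) (auto, metis AB not_le)
  also have "\<dots> = (\<Sum>n\<le>m. (\<Sum>i\<le>n. A i * B (n - i)) $ m)"
    by (simp add: sum.triangle_reindex_eq fps_sum_nth)
  also have "\<dots> = suminf (\<lambda>n. \<Sum>i\<le>n. A i * B (n - i)) $ m"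
    by (subst fps_suminf_nth) (auto simp: fps_sum_nth AB)
  finally show "(suminf A * suminf B) $ m = \<dots>" .
qed

text \<open>
  Evaluation at a series without constant term is a ring homomorphism from the rational series. It
  transports the identity \<open>log (exp t) = t\<close> to noncommutative coefficients.
\<close>

definition fps_ev :: "rat fps \<Rightarrow> 'a::rat_algebra fps \<Rightarrow> 'a fps"
  where "fps_ev f y = suminf (\<lambda>k. (f $ k) *\<^sub>Q y ^ k)"

lemma fps_ev_nth:
  assumes "y $ 0 = 0"
  shows "fps_ev f y $ m = (\<Sum>k\<le>m. (f $ k) *\<^sub>Q ((y ^ k) $ m))"
  unfolding fps_ev_def by (subst fps_suminf_nth) (simp_all add: fps_power_nth_eq_0 assms)

text \<open>Powers of the single element \<open>y\<close> commute with each other and rational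
  scalars are central, so the Cauchy product of the evaluations collects as over a commutative
  ring.\<close>

lemma fps_ev_mult:
  assumes "y $ 0 = 0"
  shows "fps_ev (f * g) y = fps_ev f y * fps_ev g y"
proof -
  have "((f * g) $ n) *\<^sub>Q y ^ n = (\<Sum>i\<le>n. ((f $ i) *\<^sub>Q y ^ i) * ((g $ (n - i)) *\<^sub>Q y ^ (n - i)))" for n
    by (simp add: fps_mult_nth ratmod.scale_sum_left mult_scaleQ_left mult_scaleQ_right
        mult.commute atLeast0AtMost flip: power_add)
  then show ?thesis
    unfolding fps_ev_def by (subst fps_suminf_mult) (simp_all add: fps_power_nth_eq_0 assms)
qed

lemma fps_ev_1:
  assumes "y $ 0 = 0"
  shows "fps_ev 1 y = 1"
proof (rule fps_ext)
  fix m
  have "fps_ev 1 y $ m = (\<Sum>k\<le>m. if k = 0 then (1 :: 'a fps) $ m else 0)"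
    unfolding fps_ev_nth[OF assms] by (intro sum.cong) auto
  then show "fps_ev 1 y $ m = (1 :: 'a fps) $ m" by simp
qed

lemma fps_ev_X:
  assumes "y $ 0 = 0"
  shows "fps_ev fps_X y = y"
proof (rule fps_ext)
  fix m
  have "fps_ev fps_X y $ m = (\<Sum>k\<le>m. if k = 1 then y $ m else 0)"
    unfolding fps_ev_nth[OF assms] by (intro sum.cong) auto
  then show "fps_ev fps_X y $ m = y $ m" using assms by (cases m) simp_all
qed

lemma fps_ev_power:
  assumes "y $ 0 = 0"
  shows "fps_ev (f ^ n) y = fps_ev f y ^ n"
  by (induction n) (simp_all add: assms fps_ev_1 fps_ev_mult)

lemma fps_ev_diff:
  assumes "y $ 0 = 0"
  shows "fps_ev (f - g) y = fps_ev f y - fps_ev g y"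
  by (rule fps_ext) (simp add: fps_ev_nth assms ratmod.scale_left_diff_distrib sum_subtractf)

lemma fps_ev_nth_0 [simp]:
  assumes "y $ 0 = 0"
  shows "fps_ev f y $ 0 = (f $ 0) *\<^sub>Q 1"
  by (simp add: fps_ev_nth assms)

text \<open>In each degree both sides are the same finite double sum, taken in different orders;
  powers of \<open>fps_ev g y\<close> are evaluations of powers of \<open>g\<close>.\<close>

lemma fps_ev_compose:
  assumes "y $ 0 = 0" "g $ 0 = 0"
  shows "fps_ev f (fps_ev g y) = fps_ev (f oo g) y"
proof (rule fps_ext)
  fix m
  have "fps_ev g y $ 0 = 0" using assms by simp
  then have "fps_ev f (fps_ev g y) $ m = (\<Sum>k\<le>m. (f $ k) *\<^sub>Q (\<Sum>n\<le>m. (g ^ k $ n) *\<^sub>Q ((y ^ n) $ m)))"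
    by (simp add: fps_ev_nth[of "fps_ev g y"] fps_ev_nth[OF assms(1), of "g ^ _"] flip: fps_ev_power[OF assms(1)])
  also have "\<dots> = (\<Sum>n\<le>m. (\<Sum>k\<le>m. f $ k * (g ^ k $ n)) *\<^sub>Q ((y ^ n) $ m))"
    unfolding ratmod.scale_sum_right ratmod.scale_sum_left scaleQ_scaleQ by (rule sum.swap)
  also have "\<dots> = (\<Sum>n\<le>m. ((f oo g) $ n) *\<^sub>Q ((y ^ n) $ m))"
  proof (intro sum.cong refl)
    fix n assume "n \<in> {..m}"
    \<comment> \<open>\<open>g ^ k\<close> starts in degree \<open>k\<close>, so the terms with
      \<open>k > n\<close> vanish.\<close>
    then have "(\<Sum>k\<le>m. f $ k * (g ^ k $ n)) = (f oo g) $ n"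
      unfolding fps_compose_nth by (intro sum.mono_neutral_right) (auto simp: fps_power_nth_eq_0 assms)
    then show "(\<Sum>k\<le>m. f $ k * (g ^ k $ n)) *\<^sub>Q ((y ^ n) $ m) = ((f oo g) $ n) *\<^sub>Q ((y ^ n) $ m)" by simp
  qed
  finally show "fps_ev f (fps_ev g y) $ m = fps_ev (f oo g) y $ m"
    by (simp add: fps_ev_nth assms)
qed

lemma fps_Exp_eq_fps_ev: "fps_Exp y = fps_ev (fps_exp 1) y"
  by (simp add: fps_Exp_def fps_ev_def)

lemma fps_Log_eq_fps_ev:
  assumes "x $ 0 = 1"
  shows "fps_Log x = fps_ev (fps_ln 1) (x - 1)"
proof (rule fps_ext)
  fix m
  define z where "z = x - 1"
  have z: "z $ 0 = 0" by (simp add: z_def assms)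
  have "(z * z ^ n) $ j = 0" if "j < n" for j n
    using fps_power_nth_eq_0[OF z, of j "Suc n"] that by simp
  then have "fps_Log x $ m = (\<Sum>n\<le>m. ((-1) ^ n / of_nat (Suc n)) *\<^sub>Q ((z ^ Suc n) $ m))"
    unfolding fps_Log_def z_def[symmetric] by (subst fps_suminf_nth) simp_all
  also have "\<dots> = (\<Sum>n\<le>m. (fps_ln 1 $ Suc n) *\<^sub>Q ((z ^ Suc n) $ m))"
    by (simp add: fps_ln_nth)
  \<comment> \<open>The index shift adds only \<open>k = 0\<close>, where \<open>fps_ln 1\<close>
    has coefficient 0. The term \<open>k = Suc m\<close> is dropped next, because
    \<open>z ^ Suc m\<close> has no coefficient in degree \<open>m\<close>.\<close>
  also have "\<dots> = (\<Sum>k\<le>Suc m. (fps_ln 1 $ k) *\<^sub>Q ((z ^ k) $ m))"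
    by (subst sum.atMost_Suc_shift) simp
  also have "\<dots> = (\<Sum>k\<le>m. (fps_ln 1 $ k) *\<^sub>Q ((z ^ k) $ m))"
    by (simp only: sum.atMost_Suc fps_power_nth_eq_0[OF z lessI]) simp
  finally show "fps_Log x $ m = fps_ev (fps_ln 1) z $ m"
    by (simp add: fps_ev_nth z)
qed

lemma fps_Exp_nth_0: "y $ 0 = 0 \<Longrightarrow> fps_Exp y $ 0 = 1"
  by (simp add: fps_Exp_eq_fps_ev)

text \<open>Evaluating the rational identity log(1 + (exp t - 1)) = t at \<open>y\<close> gives the
  claim.\<close>

lemma fps_Log_Exp:
  assumes "y $ 0 = 0"
  shows "fps_Log (fps_Exp y) = y"
proof -
  have "fps_Exp y - 1 = fps_ev (fps_exp 1 - 1) y"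
    by (simp add: fps_Exp_eq_fps_ev fps_ev_diff fps_ev_1 assms)
  then have "fps_Log (fps_Exp y) = fps_ev (fps_ln 1 oo (fps_exp 1 - 1)) y"
    by (simp add: fps_Log_eq_fps_ev fps_Exp_nth_0 fps_ev_compose assms)
  also have "fps_ln 1 oo (fps_exp 1 - 1) = (fps_X :: rat fps)"
    by (simp add: fps_ln_fps_exp_inv fps_inv)
  finally show ?thesis by (simp add: fps_ev_X assms)
qed

section \<open>The exponential of a sum of commuting series\<close>

text \<open>This is the binomial theorem in terms of divided powers, where the binomial coefficients
  disappear. The induction multiplies by \<open>x + y\<close> and uses that \<open>x\<close> times
  the \<open>n\<close>-th divided power is \<open>Suc n\<close> times the next one.\<close>

lemma scaleQ_exp_series_add_commuting:
  fixes x y :: "'a::rat_algebra"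
  assumes "x * y = y * x"
  shows "(1 / fact n) *\<^sub>Q (x + y) ^ n =
    (\<Sum>i\<le>n. ((1 / fact i) *\<^sub>Q x ^ i) * ((1 / fact (n - i)) *\<^sub>Q y ^ (n - i)))"
proof (induction n)
  case (Suc n)
  define S :: "'a \<Rightarrow> nat \<Rightarrow> 'a" where "S x n = (1 / fact n) *\<^sub>Q x ^ n" for x n
  have times_S: "x * S x n = of_nat (Suc n) *\<^sub>Q S x (Suc n)" for x n
    by (simp add: S_def mult_scaleQ_right scaleQ_scaleQ del: of_nat_Suc)
  have S_comm: "y * S x n = S x n * y" for n
    by (simp add: S_def mult_scaleQ_left mult_scaleQ_right power_commuting_commutes assms)
  have "of_nat (Suc n) *\<^sub>Q S (x + y) (Suc n) = (x + y) * (\<Sum>i\<le>n. S x i * S y (n - i))"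
    using Suc.IH by (simp only: times_S[symmetric]) (simp add: S_def)
  also have "\<dots> = (\<Sum>i\<le>n. x * S x i * S y (n - i)) + (\<Sum>i\<le>n. S x i * (y * S y (n - i)))"
    unfolding distrib_right sum_distrib_left mult.assoc[symmetric] S_comm sum.distrib ..
  also have "\<dots> = (\<Sum>i\<le>n. of_nat (Suc i) *\<^sub>Q (S x (Suc i) * S y (n - i)))
      + (\<Sum>i\<le>n. of_nat (Suc n - i) *\<^sub>Q (S x i * S y (Suc n - i)))"
    by (simp add: times_S Suc_diff_le mult_scaleQ_left mult_scaleQ_right del: of_nat_Suc)
  also have "(\<Sum>i\<le>n. of_nat (Suc i) *\<^sub>Q (S x (Suc i) * S y (n - i)))
      = (\<Sum>i\<le>Suc n. of_nat i *\<^sub>Q (S x i * S y (Suc n - i)))"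
    by (subst sum.atMost_Suc_shift) simp
  also have "(\<Sum>i\<le>n. of_nat (Suc n - i) *\<^sub>Q (S x i * S y (Suc n - i)))
      = (\<Sum>i\<le>Suc n. of_nat (Suc n - i) *\<^sub>Q (S x i * S y (Suc n - i)))"
    by simp
  \<comment> \<open>The terms added at the two ends have weight 0. The weights \<open>i\<close> and
    \<open>Suc n - i\<close> now add up to the constant \<open>Suc n\<close>, which is divided out
    at the end.\<close>
  also have "(\<Sum>i\<le>Suc n. of_nat i *\<^sub>Q (S x i * S y (Suc n - i)))
      + (\<Sum>i\<le>Suc n. of_nat (Suc n - i) *\<^sub>Q (S x i * S y (Suc n - i)))
      = (\<Sum>i\<le>Suc n. of_nat (Suc n) *\<^sub>Q (S x i * S y (Suc n - i)))"
    unfolding sum.distrib[symmetric] scaleQ_add_left[symmetric] of_nat_add[symmetric]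
    by (intro sum.cong) auto
  also have "\<dots> = of_nat (Suc n) *\<^sub>Q (\<Sum>i\<le>Suc n. S x i * S y (Suc n - i))"
    by (simp only: ratmod.scale_sum_right)
  finally have "(1 / of_nat (Suc n)) *\<^sub>Q of_nat (Suc n) *\<^sub>Q S (x + y) (Suc n) =
      (1 / of_nat (Suc n)) *\<^sub>Q of_nat (Suc n) *\<^sub>Q (\<Sum>i\<le>Suc n. S x i * S y (Suc n - i))"
    by simp
  then show ?case
    unfolding S_def by (simp add: scaleQ_scaleQ del: of_nat_Suc)
qed simp

lemma fps_Exp_add:
  assumes "x $ 0 = 0" "y $ 0 = 0" "x * y = y * x"
  shows "fps_Exp (x + y) = fps_Exp x * fps_Exp y"
  unfolding fps_Exp_def scaleQ_exp_series_add_commuting[OF assms(3)]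
  by (subst fps_suminf_mult) (simp_all add: fps_power_nth_eq_0 assms)

lemma fps_power_nth_cong:
  fixes y z :: "'a::{semiring_0, monoid_mult} fps"
  assumes "\<And>j. j \<le> m \<Longrightarrow> y $ j = z $ j"
  shows "(y ^ k) $ m = (z ^ k) $ m"
  using assms
proof (induction k arbitrary: m)
  case (Suc k)
  then show ?case by (auto simp: fps_mult_nth intro!: sum.cong)
qed simp

text \<open>This is the continuity of evaluation in the t-adic topology; it lets the exponential
  pass to the limit defining \<open>E_series\<close>.\<close>

lemma fps_ev_nth_cong:
  assumes "y $ 0 = 0" "\<And>j. j \<le> m \<Longrightarrow> y $ j = z $ j"
  shows "fps_ev f y $ m = fps_ev f z $ m"
proof -
  have "z $ 0 = 0" using assms(1) assms(2)[of 0] by simp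
  then show ?thesis
    by (simp add: fps_ev_nth assms(1) fps_power_nth_cong[OF assms(2)])
qed

section \<open>The substitution of \<open>- t ^ r\<close>\<close>

text \<open>Signs are moved from the algebra into the rational scalars, where they are central and
  cancel by computation.\<close>

lemma minus_one_power_scaleQ: "(-1) ^ n = ((-1) ^ n) *\<^sub>Q (1 :: 'a::rat_algebra)"
proof (induction n)
  case (Suc n)
  have "(-1) * x = - x" for x :: 'a
    using mult_minus_left[of 1 x] by simp
  then show ?case by (simp add: Suc.IH)
qed simp

text \<open>The terms of the logarithms and substitutions below all have this shape, so their
  coefficients can be read off.\<close>

definition fps_monom :: "nat \<Rightarrow> 'a \<Rightarrow> 'a::rat_algebra fps"
  where "fps_monom k u = Abs_fps (\<lambda>n. if n = k then u else 0)"

lemma fps_monom_nth [simp]: "fps_monom k u $ n = (if n = k then u else 0)"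
  by (simp add: fps_monom_def)

lemma fps_monom_mult: "fps_monom k u * fps_monom l v = fps_monom (k + l) (u * v)"
proof (rule fps_ext)
  fix n
  have "(fps_monom k u * fps_monom l v) $ n = (\<Sum>i=0..n. if i = k then (if n = k + l then u * v else 0) else 0)"
    unfolding fps_mult_nth by (intro sum.cong) auto
  then show "(fps_monom k u * fps_monom l v) $ n = fps_monom (k + l) (u * v) $ n"
    by simp
qed

lemma fps_monom_power: "fps_monom k u ^ n = fps_monom (k * n) (u ^ n)"
proof (induction n)
  case 0
  show ?case by (rule fps_ext) simp
qed (simp add: fps_monom_mult)

lemma fps_X_power_eq_monom: "fps_X ^ n = fps_monom n (1 :: 'a::rat_algebra)"
proof -
  have "fps_X = fps_monom 1 (1 :: 'a)" by (rule fps_ext) simp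
  show ?thesis unfolding \<open>fps_X = _\<close> fps_monom_power by simp
qed

lemma uminus_fps_monom: "- fps_monom n u = fps_monom n (- u)"
  by (rule fps_ext) simp

lemma scaleQ_fps_monom: "q *\<^sub>Q fps_monom n u = fps_monom n (q *\<^sub>Q u)"
  by (rule fps_ext) simp

lemma fps_const_eq_monom: "fps_const u = fps_monom 0 u"
  by (rule fps_ext) simp

lemma uminus_fps_X_power: "(- fps_X) ^ n = fps_monom n (((-1) ^ n) *\<^sub>Q (1 :: 'a::rat_algebra))"
proof -
  have "- fps_X = fps_monom 1 (- 1 :: 'a)" by (rule fps_ext) simp
  show ?thesis unfolding \<open>- fps_X = _\<close> fps_monom_power by (simp add: minus_one_power_scaleQ)
qed

text \<open>The \<open>k\<close>-th term of the substitution is a monomial of degree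
  \<open>r * k\<close>, so at most \<open>k = m div r\<close> contributes.\<close>

lemma fps_subst_nth:
  assumes "r > 0"
  shows "fps_subst f (- (fps_X ^ r)) $ m =
    (if r dvd m then ((-1) ^ (m div r)) *\<^sub>Q (f $ (m div r)) else 0 :: 'a::rat_algebra)"
proof -
  have summand: "fps_const (f $ k) * (- (fps_X ^ r)) ^ k = fps_monom (r * k) (((-1) ^ k) *\<^sub>Q (f $ k))" for k
    by (simp add: fps_X_power_eq_monom uminus_fps_monom fps_monom_power fps_const_eq_monom
        fps_monom_mult minus_one_power_scaleQ mult_scaleQ_right)
  have "fps_subst f (- (fps_X ^ r)) $ m = (\<Sum>k\<le>m. if m = r * k then ((-1) ^ k) *\<^sub>Q (f $ k) else 0)"
    unfolding fps_subst_def summand using assms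
    by (subst fps_suminf_nth) (auto simp: nat_less_iff)
  also have "\<dots> = (\<Sum>k\<le>m. if k = m div r then (if r dvd m then ((-1) ^ (m div r)) *\<^sub>Q (f $ (m div r)) else 0) else 0)"
    using assms by (intro sum.cong) auto
  also have "\<dots> = (if r dvd m then ((-1) ^ (m div r)) *\<^sub>Q (f $ (m div r)) else 0)"
    by simp
  finally show ?thesis .
qed

text \<open>Substituting the central series - t^r respects products: only degrees divisible by
  \<open>r\<close> occur, and the signs multiply to the sign of the total degree.\<close>

lemma fps_subst_mult:
  fixes f g :: "'a::rat_algebra fps"
  assumes "r > 0"
  shows "fps_subst (f * g) (- (fps_X ^ r)) = fps_subst f (- (fps_X ^ r)) * fps_subst g (- (fps_X ^ r))"
    (is "?S (f * g) = ?S f * ?S g")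
proof (rule fps_ext)
  fix m
  show "?S (f * g) $ m = (?S f * ?S g) $ m"
  proof (cases "r dvd m")
    case False
    have "?S f $ i * ?S g $ (m - i) = 0" if "i \<le> m" for i
    proof -
      have "\<not> (r dvd i \<and> r dvd m - i)"
        using False that by (metis dvd_add le_add_diff_inverse)
      then show ?thesis using assms by (auto simp: fps_subst_nth)
    qed
    then show ?thesis using False assms by (simp add: fps_subst_nth fps_mult_nth)
  next
    case True
    then obtain q where m: "m = r * q" by blast
    have "(?S f * ?S g) $ m = (\<Sum>i\<in>(*) r ` {0..q}. ?S f $ i * ?S g $ (m - i))"
      unfolding fps_mult_nth
    proof (rule sum.mono_neutral_right)
      show "\<forall>i\<in>{0..m} - (*) r ` {0..q}. ?S f $ i * ?S g $ (m - i) = 0"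
        using assms by (auto simp: fps_subst_nth m elim!: dvdE)
    qed (auto simp: m)
    also have "\<dots> = (\<Sum>i=0..q. ?S f $ (r * i) * ?S g $ (r * (q - i)))"
      using assms by (subst sum.reindex) (auto simp: inj_on_def m right_diff_distrib')
    also have "\<dots> = (\<Sum>i=0..q. ((-1) ^ q) *\<^sub>Q (f $ i * g $ (q - i)))"
      using assms by (intro sum.cong)
        (auto simp: fps_subst_nth mult_scaleQ_left mult_scaleQ_right scaleQ_scaleQ simp flip: power_add)
    also have "\<dots> = ?S (f * g) $ m"
      using assms by (simp add: fps_subst_nth m fps_mult_nth ratmod.scale_sum_right)
    finally show ?thesis by simp
  qed
qed

lemma fps_subst_power:
  fixes f :: "'a::rat_algebra fps"
  assumes "r > 0"
  shows "fps_subst (f ^ n) (- (fps_X ^ r)) = fps_subst f (- (fps_X ^ r)) ^ n"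
proof (induction n)
  case 0
  show ?case by (rule fps_ext) (use assms in \<open>auto simp: fps_subst_nth\<close>)
qed (simp add: fps_subst_mult assms)

text \<open>Substitution respects powers, hence evaluation; this moves it inside the exponential
  that defines E_U.\<close>

lemma fps_subst_ev:
  fixes y :: "'a::rat_algebra fps"
  assumes "r > 0" "y $ 0 = 0"
  shows "fps_subst (fps_ev f y) (- (fps_X ^ r)) = fps_ev f (fps_subst y (- (fps_X ^ r)))"
proof (rule fps_ext)
  fix m
  let ?S = "\<lambda>z. fps_subst z (- (fps_X ^ r)) :: 'a fps"
  have y0: "?S y $ 0 = 0" using assms by (simp add: fps_subst_nth)
  show "?S (fps_ev f y) $ m = fps_ev f (?S y) $ m"
  proof (cases "r dvd m")
    case False
    then show ?thesis
      using assms y0 by (simp add: fps_ev_nth fps_subst_nth flip: fps_subst_power)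
  next
    case True
    then obtain q where m: "m = r * q" by blast
    \<comment> \<open>\<open>y ^ k\<close> starts in degree \<open>k\<close>, so the bound
      \<open>m\<close> may be lowered to \<open>q\<close>.\<close>
    have "(\<Sum>k\<le>m. c k *\<^sub>Q ((y ^ k) $ q)) = (\<Sum>k\<le>q. c k *\<^sub>Q ((y ^ k) $ q))" for c
      using assms by (intro sum.mono_neutral_right) (auto simp: m fps_power_nth_eq_0)
    then show ?thesis
      using assms y0
      by (simp add: fps_ev_nth fps_subst_nth m ratmod.scale_sum_right scaleQ_scaleQ mult.commute
          flip: fps_subst_power)
  qed
qed

section \<open>The canonical maps\<close>

lemma enveloping_of_add: "enveloping_of (x + y) = enveloping_of x + enveloping_of y"
proof transfer
  fix x y :: 'a
  have "letter (x + y) - letter x - letter y \<in> enveloping_rels"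
    by (auto simp: enveloping_rels_def)
  from ideal_hull_base[OF this]
  show "ideal_cong enveloping_rels (letter (x + y)) (letter x + letter y)"
    by (simp add: ideal_cong_def algebra_simps)
qed

lemma enveloping_of_scaleQ: "enveloping_of (q *\<^sub>Q x) = q *\<^sub>Q enveloping_of x"
proof transfer
  fix q and x :: 'a
  have "letter (q *\<^sub>Q x) - Poly_Mapping.single 0 q * letter x \<in> enveloping_rels"
    by (auto simp: enveloping_rels_def)
  from ideal_hull_base[OF this]
  show "ideal_cong enveloping_rels (letter (q *\<^sub>Q x)) (Poly_Mapping.single 0 q * letter x)"
    by (simp add: ideal_cong_def)
qed

lemma inf_tensor_of_add:
  assumes "i \<ge> 1"
  shows "inf_tensor_of i (x + y) = inf_tensor_of i x + inf_tensor_of i y"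
  using assms
proof transfer
  fix i :: nat and x y :: 'a
  assume "i \<ge> 1"
  then have "pfam (family_upd 0 i (x + y)) - pfam (family_upd 0 i x) - pfam (family_upd 0 i y)
      \<in> multilinear_rels"
    by (auto simp: multilinear_rels_def)
  from ideal_hull_base[OF this]
  show "ideal_cong multilinear_rels (pfam (family_upd 0 i (x + y)))
      (pfam (family_upd 0 i x) + pfam (family_upd 0 i y))"
    by (simp add: ideal_cong_def algebra_simps)
qed

lemma inf_tensor_of_scaleQ:
  assumes "i \<ge> 1"
  shows "inf_tensor_of i (q *\<^sub>Q x) = q *\<^sub>Q inf_tensor_of i x"
  using assms
proof transfer
  fix i :: nat and q and x :: 'a
  assume "i \<ge> 1"
  then have "pfam (family_upd 0 i (q *\<^sub>Q x)) - Poly_Mapping.single 0 q * pfam (family_upd 0 i x)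
      \<in> multilinear_rels"
    unfolding multilinear_rels_def by blast
  from ideal_hull_base[OF this]
  show "ideal_cong multilinear_rels (pfam (family_upd 0 i (q *\<^sub>Q x)))
      (Poly_Mapping.single 0 q * pfam (family_upd 0 i x))"
    by (simp add: ideal_cong_def)
qed

text \<open>The two families differ from 1 at most at \<open>i\<close> and at \<open>j\<close>
  respectively, so in each component one of the two factors is 1.\<close>

lemma inf_tensor_of_commute:
  assumes "i \<noteq> j"
  shows "inf_tensor_of i x * inf_tensor_of j y = inf_tensor_of j y * inf_tensor_of i x"
  using assms
proof transfer
  fix i j :: nat and x y :: 'a
  assume "i \<noteq> j"
  then have "family_upd 0 i x + family_upd 0 j y = family_upd 0 j y + family_upd 0 i x"
    by (auto simp: component_inject[symmetric] plus_family.rep_eq family_upd.rep_eq zero_family.rep_eq)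
  then show "ideal_cong multilinear_rels (pfam (family_upd 0 i x) * pfam (family_upd 0 j y))
      (pfam (family_upd 0 j y) * pfam (family_upd 0 i x))"
    by (simp add: pfam_def mult_single ideal_cong_refl)
qed

text \<open>Index 0 has to be excluded, since \<open>T_map 0\<close> is constantly 1.\<close>

lemma T_map_add: "i \<ge> 1 \<Longrightarrow> T_map i (x + y) = T_map i x + T_map i y"
  by (simp add: T_map_def enveloping_of_add inf_tensor_of_add)

lemma T_map_scaleQ: "i \<ge> 1 \<Longrightarrow> T_map i (q *\<^sub>Q x) = q *\<^sub>Q T_map i x"
  by (simp add: T_map_def enveloping_of_scaleQ inf_tensor_of_scaleQ)

lemma T_map_0: "i \<ge> 1 \<Longrightarrow> T_map i 0 = 0"
  using T_map_scaleQ[of i 0 0] by simp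

lemma T_map_commute: "i \<noteq> j \<Longrightarrow> T_map i x * T_map j y = T_map j y * T_map i x"
  by (simp add: T_map_def inf_tensor_of_commute)

section \<open>The ring homomorphism from R to its rationalization\<close>

lemma rat_tensor_of_add: "rat_tensor_of (x + y) = rat_tensor_of x + rat_tensor_of y"
proof transfer
  fix x y :: 'a
  have "ptens 1 (x + y) - ptens 1 x - ptens 1 y \<in> biadditive_rels"
    unfolding biadditive_rels_def by blast
  from ideal_hull_base[OF this]
  show "ideal_cong biadditive_rels (ptens 1 (x + y)) (ptens 1 x + ptens 1 y)"
    by (simp add: ideal_cong_def algebra_simps)
qed

lemma rat_tensor_of_mult: "rat_tensor_of (x * y) = rat_tensor_of x * rat_tensor_of y"
  by transfer (simp add: ptens_mult ideal_cong_refl)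

lemma rat_tensor_of_1: "rat_tensor_of 1 = 1"
  by transfer (simp add: ptens_one ideal_cong_refl)

lemma rat_tensor_of_power: "rat_tensor_of (x ^ n) = rat_tensor_of x ^ n"
  by (induction n) (simp_all add: rat_tensor_of_1 rat_tensor_of_mult)

section \<open>The coefficients of \<open>log E\<^sub>U\<close> and \<open>F\<^sub>U\<close>\<close>

text \<open>The logarithm is - \<Sum> (-t)^(lk) u^k / k over k \<ge> 1, and in degree
  \<open>m\<close> only k = \<open>m div l\<close> can occur.\<close>

lemma fps_Log_one_minus_nth:
  assumes "l \<ge> 1"
  shows "fps_Log (1 - (- fps_X) ^ l * fps_const (u :: 'a::rat_algebra)) $ m =
    (if m > 0 \<and> l dvd m then (- ((-1) ^ m / of_nat (m div l))) *\<^sub>Q u ^ (m div l) else 0)"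
proof -
  let ?x = "1 - (- fps_X) ^ l * fps_const u"
  have x: "?x - 1 = fps_monom l ((- ((-1) ^ l)) *\<^sub>Q u)"
    by (simp add: uminus_fps_X_power fps_const_eq_monom fps_monom_mult mult_scaleQ_left
        uminus_fps_monom)
  \<comment> \<open>The sign (-1)^n of the logarithm series and the sign (-1)^(n+1) from the power
    combine to -1.\<close>
  have summand: "((-1) ^ n / of_nat (Suc n)) *\<^sub>Q (?x - 1) ^ Suc n =
      fps_monom (l * Suc n) ((- ((-1) ^ (l * Suc n) / of_nat (Suc n))) *\<^sub>Q u ^ Suc n)" for n
  proof -
    have "(- ((-1) ^ l)) ^ Suc n = (-1 :: rat) ^ Suc n * (-1) ^ (l * Suc n)"
      by (simp only: power_minus[of "(-1) ^ l"] power_mult)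
    moreover have "(-1) ^ n / of_nat (Suc n) * ((-1) ^ Suc n * c) = - (c / of_nat (Suc n))" for c :: rat
      by (simp del: of_nat_Suc flip: power_add mult_2)
    ultimately show ?thesis
      unfolding x fps_monom_power scaleQ_power scaleQ_fps_monom scaleQ_scaleQ by simp
  qed
  have "fps_Log ?x $ m = (\<Sum>n\<le>m. if m = l * Suc n
      then (- ((-1) ^ (l * Suc n) / of_nat (Suc n))) *\<^sub>Q u ^ Suc n else 0)"
    unfolding fps_Log_def summand
  proof (subst fps_suminf_nth)
    fix i j :: nat
    assume "j < i"
    also have "i < 1 * Suc i" by simp
    also have "\<dots> \<le> l * Suc i" using assms by (rule mult_le_mono1)
    finally show "fps_monom (l * Suc i) ((- ((-1) ^ (l * Suc i) / of_nat (Suc i))) *\<^sub>Q u ^ Suc i) $ j = 0"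
      by simp
  qed (simp only: fps_monom_nth)
  \<comment> \<open>The logarithm series is indexed by n = k - 1. For \<open>m < l\<close> the
    truncated subtraction would select \<open>n = 0\<close>, hence the inner condition on
    \<open>m\<close>.\<close>
  also have "\<dots> = (\<Sum>n\<le>m. if n = m div l - 1 then (if m > 0 \<and> l dvd m
      then (- ((-1) ^ m / of_nat (m div l))) *\<^sub>Q u ^ (m div l) else 0) else 0)"
  proof (intro sum.cong refl)
    fix n
    have "m = l * Suc n \<longleftrightarrow> m > 0 \<and> l dvd m \<and> n = m div l - 1"
    proof
      assume *: "m > 0 \<and> l dvd m \<and> n = m div l - 1"
      then have "m div l \<noteq> 0" using assms by (auto simp: dvd_div_eq_0_iff)
      with * have "Suc n = m div l" by simp
      with * show "m = l * Suc n" by simp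
    qed (use assms in auto)
    moreover have "Suc n = m div l" if "m = l * Suc n" using that assms by simp
    ultimately show "(if m = l * Suc n
      then (- ((-1) ^ (l * Suc n) / of_nat (Suc n))) *\<^sub>Q u ^ Suc n else 0) =
      (if n = m div l - 1 then (if m > 0 \<and> l dvd m
      then (- ((-1) ^ m / of_nat (m div l))) *\<^sub>Q u ^ (m div l) else 0) else 0)"
      by (cases "m = l * Suc n") (simp_all del: of_nat_Suc mult_Suc_right, auto)
  qed
  also have "\<dots> = (if m > 0 \<and> l dvd m
      then (- ((-1) ^ m / of_nat (m div l))) *\<^sub>Q u ^ (m div l) else 0)"
    by (auto simp: le_diff_conv intro: le_trans[OF div_le_dividend])
  finally show ?thesis .
qed

section \<open>The factors of E_U and their exponents\<close>

definition Theta_log :: "'a::{ring, monoid_mult} \<Rightarrow> nat \<Rightarrow> 'a G_inf fps"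
  where "Theta_log U l = fps_map (T_map l) (fps_Log (1 - (- fps_X) ^ l * fps_const (rat_tensor_of U)))"

lemma Theta_log_nth:
  assumes "l \<ge> 1"
  shows "Theta_log U l $ m = (if m > 0 \<and> l dvd m
    then (- ((-1) ^ m / of_nat (m div l))) *\<^sub>Q T_map l (rat_tensor_of (U ^ (m div l))) else 0)"
  using assms
  by (simp add: Theta_log_def fps_map_def fps_Log_one_minus_nth T_map_scaleQ T_map_0 rat_tensor_of_power
      del: ratmod.scale_minus_left)

text \<open>Coefficients from different tensor positions commute; reversing the convolution index
  does the rest.\<close>

lemma Theta_log_commute:
  assumes "i \<noteq> j"
  shows "Theta_log U i * Theta_log V j = Theta_log V j * Theta_log U i"
proof (rule fps_ext)
  fix n
  have "(Theta_log U i * Theta_log V j) $ n = (\<Sum>k=0..n. Theta_log V j $ (n - k) * Theta_log U i $ k)"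
    unfolding fps_mult_nth by (simp add: Theta_log_def fps_map_def T_map_commute[OF assms])
  also have "\<dots> = (Theta_log V j * Theta_log U i) $ n"
    unfolding fps_mult_nth by (rule sum.reindex_bij_witness[where i = "\<lambda>k. n - k" and j = "\<lambda>k. n - k"]) auto
  finally show "(Theta_log U i * Theta_log V j) $ n = (Theta_log V j * Theta_log U i) $ n" .
qed

text \<open>The sum of the first \<open>N\<close> exponents commutes with the next one, as their
  indices differ, so exponentials multiply.\<close>

lemma Theta_prod_eq_Exp:
  "prod_list (map (\<lambda>l. Theta l (1 - (- fps_X) ^ l * fps_const (rat_tensor_of U))) [1..<Suc N]) =
    fps_Exp (\<Sum>l=1..N. Theta_log U l)"
proof (induction N)
  case 0
  show ?case
  proof (rule fps_ext)
    fix n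
    have "(0 ^ k :: 'a G_inf fps) $ n = 0" if "n > 0" for k
      using that by (cases k) simp_all
    then show "prod_list (map (\<lambda>l. Theta l (1 - (- fps_X) ^ l * fps_const (rat_tensor_of U))) [1..<Suc 0]) $ n =
        fps_Exp (\<Sum>l=1..0. Theta_log U l) $ n"
      by (cases "n = 0") (simp_all add: fps_Exp_eq_fps_ev fps_ev_nth)
  qed
next
  case (Suc N)
  have "fps_Exp (\<Sum>l=1..Suc N. Theta_log U l) =
      fps_Exp (\<Sum>l=1..N. Theta_log U l) * fps_Exp (Theta_log U (Suc N))"
    by (simp, subst fps_Exp_add)
      (auto simp: fps_sum_nth Theta_log_nth sum_distrib_left sum_distrib_right Theta_log_commute
        intro!: sum.cong sum.neutral)
  also have "fps_Exp (Theta_log U (Suc N)) =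
      Theta (Suc N) (1 - (- fps_X) ^ Suc N * fps_const (rat_tensor_of U))"
    by (simp only: Theta_def Theta_log_def)
  moreover have "[1..<Suc (Suc N)] = [1..<Suc N] @ [Suc N]" by simp
  ultimately show ?case
    by (simp only: map_append prod_list.append Suc.IH list.map prod_list.Cons prod_list.Nil mult_1_right)
qed

text \<open>This is the sum of all \<open>Theta_log U l\<close>, taken by coefficients:
  \<open>Theta_log U l\<close> starts in degree \<open>l\<close>, so l \<le> m suffices in degree
  \<open>m\<close>.\<close>

definition E_log :: "'a::{ring, monoid_mult} \<Rightarrow> 'a G_inf fps"
  where "E_log U = Abs_fps (\<lambda>m. \<Sum>l=1..m. Theta_log U l $ m)"

lemma E_log_nth_0 [simp]: "E_log U $ 0 = 0"
  by (simp add: E_log_def)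

lemma E_log_nth:
  assumes "m > 0"
  shows "E_log U $ m =
    (\<Sum>l | l dvd m. (- ((-1) ^ m / of_nat (m div l))) *\<^sub>Q T_map l (rat_tensor_of (U ^ (m div l))))"
proof -
  have "E_log U $ m = (\<Sum>l=1..m. if l dvd m
      then (- ((-1) ^ m / of_nat (m div l))) *\<^sub>Q T_map l (rat_tensor_of (U ^ (m div l))) else 0)"
    unfolding E_log_def fps_nth_Abs_fps using assms by (intro sum.cong) (simp_all add: Theta_log_nth)
  also have "\<dots> = (\<Sum>l | l \<in> {1..m} \<and> l dvd m.
      (- ((-1) ^ m / of_nat (m div l))) *\<^sub>Q T_map l (rat_tensor_of (U ^ (m div l))))"
    by (rule sum.inter_filter[symmetric]) simp
  also have "{l. l \<in> {1..m} \<and> l dvd m} = {l. l dvd m}"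
    using assms by (auto intro: dvd_imp_le Suc_leI dvd_pos_nat)
  finally show ?thesis .
qed

text \<open>Once N \<ge> n, the partial sums of the exponents agree with \<open>E_log U\<close> up
  to degree \<open>n\<close>, and hence so do their exponentials.\<close>

lemma E_series_eq_Exp: "E_series U = fps_Exp (E_log U)"
  unfolding E_series_def Theta_prod_eq_Exp
proof (rule limI, rule tendsto_fpsI)
  fix n
  show "\<forall>\<^sub>F N in sequentially. fps_Exp (\<Sum>l=1..N. Theta_log U l) $ n = fps_Exp (E_log U) $ n"
    using eventually_ge_at_top[of n]
  proof eventually_elim
    case (elim N)
    have "(\<Sum>l=1..N. Theta_log U l) $ j = E_log U $ j" if "j \<le> n" for j
      unfolding E_log_def fps_sum_nth fps_nth_Abs_fps using that elim
      by (intro sum.mono_neutral_right) (auto simp: Theta_log_nth dest: dvd_imp_le)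
    then show ?case
      unfolding fps_Exp_eq_fps_ev by (intro fps_ev_nth_cong) (simp_all add: fps_sum_nth)
  qed
qed

text \<open>The terms with a power U^k, k > 1, carry the sum of the Moebius function over the
  divisors of k and cancel, which leaves an expression additive in \<open>U\<close>.\<close>

lemma F_series_nth: "F_series U $ m = (if m = 0 then 0 else T_map m (rat_tensor_of U))"
proof -
  define t where "t r = (moebius_mu r / of_nat r) *\<^sub>Q fps_subst (E_log (U ^ r)) (- (fps_X ^ r))" for r
  have t_0: "t r $ m = 0" if "r > 0" "\<not> (m > 0 \<and> r dvd m)" for r m
    using that by (auto simp: t_def fps_subst_nth)
  have F: "F_series U = - suminf (\<lambda>n. t (Suc n))"
  proof -
    \<comment> \<open>The substitution passes through the exponential, which the logarithm then
      undoes.\<close>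
    have "fps_Log (fps_subst (E_series V) (- (fps_X ^ r))) = fps_subst (E_log V) (- (fps_X ^ r))"
      if "r > 0" for V :: 'a and r
      using that by (simp add: E_series_eq_Exp fps_Exp_eq_fps_ev fps_subst_ev)
        (simp add: fps_Log_Exp fps_subst_nth flip: fps_Exp_eq_fps_ev)
    then show ?thesis unfolding F_series_def t_def Let_def by (simp del: power_Suc of_nat_Suc)
  qed
  have F_nth: "F_series U $ m = - (\<Sum>n\<le>m. t (Suc n) $ m)" for m
    unfolding F by (subst fps_neg_nth, subst fps_suminf_nth) (auto intro!: t_0 dest: dvd_imp_le)
  show ?thesis
  proof (cases "m = 0")
    case True
    then show ?thesis by (simp add: F_nth t_0)
  next
    case False
    define v where "v l = T_map l (rat_tensor_of (U ^ (m div l)))" for l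
    \<comment> \<open>The indices \<open>Suc n\<close> run from 1 to \<open>m + 1\<close> and so
      reach every divisor of \<open>m\<close>; the other terms vanish in degree
      \<open>m\<close>.\<close>
    have "(\<Sum>n\<le>m. t (Suc n) $ m) = (\<Sum>r | r dvd m. t r $ m)"
    proof -
      have "(\<Sum>n\<le>m. t (Suc n) $ m) = (\<Sum>r\<in>Suc ` {..m}. t r $ m)"
        by (simp add: sum.reindex)
      also have "\<dots> = (\<Sum>r | r dvd m. t r $ m)"
      proof (rule sum.mono_neutral_right)
        show "{r. r dvd m} \<subseteq> Suc ` {..m}"
        proof
          fix r assume "r \<in> {r. r dvd m}"
          with False have "r = Suc (r - 1)" "r - 1 \<le> m" by (auto dest: dvd_imp_le intro!: Suc_pred[symmetric] Nat.gr0I)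
          then show "r \<in> Suc ` {..m}" by blast
        qed
      qed (auto intro!: t_0)
      finally show ?thesis .
    qed
    also have "\<dots> = (\<Sum>r | r dvd m. \<Sum>l | l dvd m div r. - ((moebius_mu r / of_nat (m div l)) *\<^sub>Q v l))"
    proof (intro sum.cong refl)
      fix r assume "r \<in> {r. r dvd m}"
      then obtain q where m: "m = r * q" by auto
      with False have pos: "r > 0" "q > 0" by auto
      have "t r $ m = (moebius_mu r / of_nat r) *\<^sub>Q ((-1) ^ q) *\<^sub>Q
          (\<Sum>l | l dvd q. (- ((-1) ^ q / of_nat (q div l))) *\<^sub>Q T_map l (rat_tensor_of ((U ^ r) ^ (q div l))))"
        using pos by (simp add: t_def fps_subst_nth m E_log_nth del: ratmod.scale_minus_left)
      also have "\<dots> = (\<Sum>l | l dvd q. - ((moebius_mu r / of_nat (m div l)) *\<^sub>Q v l))"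
        unfolding ratmod.scale_sum_right scaleQ_scaleQ
      proof (intro sum.cong refl)
        fix l assume "l \<in> {l. l dvd q}"
        then obtain k where q: "q = l * k" by auto
        \<comment> \<open>The sign of the substitution cancels the one in \<open>E_log\<close>, and
          the denominators merge to \<open>r * k\<close>, which is \<open>m div l\<close>. The
          summand thus depends on \<open>r\<close> only through the Moebius function.\<close>
        have "moebius_mu r / of_nat r * ((-1) ^ q * - ((-1) ^ q / of_nat k)) =
            - (moebius_mu r / of_nat (r * k))"
          by (simp flip: power_add mult_2)
        moreover have "q div l = k" "m div l = r * k" "(U ^ r) ^ k = U ^ (r * k)"
          using pos q by (simp_all add: m mult.left_commute[of r l] power_mult)
        ultimately show "(moebius_mu r / of_nat r * ((-1) ^ q * - ((-1) ^ q / of_nat (q div l)))) *\<^sub>Q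
            T_map l (rat_tensor_of ((U ^ r) ^ (q div l))) = - ((moebius_mu r / of_nat (m div l)) *\<^sub>Q v l)"
          by (simp only: v_def ratmod.scale_minus_left)
      qed
      finally show "t r $ m = (\<Sum>l | l dvd m div r. - ((moebius_mu r / of_nat (m div l)) *\<^sub>Q v l))"
        using pos by (simp add: m)
    qed
    \<comment> \<open>Both double sums run over the pairs with \<open>r * l dvd m\<close>, a
      condition symmetric in \<open>r\<close> and \<open>l\<close>.\<close>
    also have "\<dots> = (\<Sum>l | l dvd m. \<Sum>r | r dvd m div l. - ((moebius_mu r / of_nat (m div l)) *\<^sub>Q v l))"
    proof -
      let ?D = "{d. d dvd m}"
      have div: "{k. k dvd m div d} = {k \<in> ?D. d * k dvd m}" if "d \<in> ?D" for d
      proof -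
        have "k dvd m div d \<longleftrightarrow> d * k dvd m" for k
          using that False dvd_div_iff_mult[of d m k] by (auto simp: mult.commute[of d k])
        then show ?thesis by (auto dest: dvd_mult_right)
      qed
      have "(\<Sum>r\<in>?D. \<Sum>l | l dvd m div r. g r l) = (\<Sum>l\<in>?D. \<Sum>r | r dvd m div l. g r l)"
        for g :: "nat \<Rightarrow> nat \<Rightarrow> 'a G_inf"
      proof -
        have "(\<Sum>r\<in>?D. \<Sum>l | l dvd m div r. g r l) = (\<Sum>r\<in>?D. \<Sum>l\<in>{l \<in> ?D. r * l dvd m}. g r l)"
          by (intro sum.cong refl div)
        also have "\<dots> = (\<Sum>l\<in>?D. \<Sum>r\<in>{r \<in> ?D. r * l dvd m}. g r l)"
          using False by (intro sum.swap_restrict) simp_all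
        also have "\<dots> = (\<Sum>l\<in>?D. \<Sum>r | r dvd m div l. g r l)"
          by (intro sum.cong refl) (simp only: div mult.commute)
        finally show ?thesis .
      qed
      then show ?thesis .
    qed
    also have "\<dots> = (\<Sum>l | l dvd m. - (((\<Sum>r | r dvd m div l. moebius_mu r) / of_nat (m div l)) *\<^sub>Q v l))"
      by (simp add: sum_negf ratmod.scale_sum_left sum_divide_distrib)
    \<comment> \<open>The inner Moebius sum vanishes unless \<open>m div l\<close> is 1, and then
      the denominator is 1 as well.\<close>
    also have "\<dots> = (\<Sum>l | l dvd m. if l = m then - v m else 0)"
    proof (intro sum.cong refl)
      fix l assume "l \<in> {l. l dvd m}"
      then obtain k where m: "m = l * k" by auto
      with False have "l > 0" "k > 0" by auto
      then show "- (((\<Sum>r | r dvd m div l. moebius_mu r) / of_nat (m div l)) *\<^sub>Q v l) =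
          (if l = m then - v m else 0)"
        by (auto simp: m moebius_sum_divisors)
    qed
    also have "\<dots> = - v m" using False by simp
    finally show ?thesis using False by (simp add: F_nth v_def)
  qed
qed

section \<open>Additivity of F_U in U and integer combinations\<close>

lemma F_series_add: "F_series (U + V) = F_series U + F_series V"
  by (rule fps_ext) (simp add: F_series_nth rat_tensor_of_add T_map_add)

text \<open>\<open>zscale\<close> is a difference of two repeated sums, and additive maps preserve
  both.\<close>

lemma additive_zscale:
  assumes "\<And>x y. f (x + y) = f x + f y"
  shows "f (zscale k x) = zscale k (f x)"
proof -
  interpret additive f by standard (rule assms)
  show ?thesis by (simp add: zscale_def diff sum)
qed

theorem theorem6p3:
  fixes I :: "'i set"
    and a :: "'i \<Rightarrow> int"
    and U :: "'i \<Rightarrow> 'a::{ring, monoid_mult}"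
    and W :: 'a
  assumes "free_Z_module TYPE('a)"
    and "finite I"
    and "W = (\<Sum>i\<in>I. zscale (a i) (U i))"
  shows "F_series W = (\<Sum>i\<in>I. zscale (a i) (F_series (U i)))"
proof -
  interpret additive "F_series :: 'a \<Rightarrow> _" by standard (rule F_series_add)
  show ?thesis
    unfolding assms(3) sum by (simp add: additive_zscale[of F_series] F_series_add)
qed

end
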